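(* For every positive integer $n$, $$\lim_{z\to 0} \frac{\Gamma(nz)}{\Gamma(z)} = \frac{1}{n}.$$
   Context: $\Gamma$ denotes the Euler Gamma function, regarded as a meromorphic function on the complex plane. It is defined by $\Gamma(z) = \frac{1}{z}\prod_{m=1}^{\infty} \frac{(1+\frac{1}{m})^{z}}{1+\frac{z}{m}}$, and its only singularities are at the nonpositive integers. The limit is taken over the complex variable $z$. *)

theory Defs
  imports "HOL-Analysis.Analysis"
begin

end

theory Submission
  imports Defs
begin

text \<open>
  The reciprocal Gamma function is entire and satisfies \<open>z * rGamma (z + 1) = rGamma z\<close>
  for every \<open>z\<close>, poles of \<open>Gamma\<close> included. Writing the quotient in terms of \<open>rGamma\<close>, the
  functional equation pulls out the simple zero at the origin from both numerator and
  denominator; the factors \<open>z\<close> and \<open>n * z\<close> contribute \<open>1 / n\<close>, and what remains is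
  continuous at the origin with value \<open>rGamma 1 / rGamma 1 = 1\<close>.
\<close>

text \<open>
  Going through \<open>rGamma\<close> makes this identity valid at the poles too, since \<open>Gamma\<close> takes the
  value \<open>0 = inverse 0\<close> there; hence no punctured neighbourhood avoiding the nonpositive
  integers has to be chosen.
\<close>

lemma Gamma_quotient_eq_rGamma_quotient:
  fixes c z :: complex
  assumes "z \<noteq> 0"
  shows "Gamma (c * z) / Gamma z = rGamma (z + 1) / (c * rGamma (c * z + 1))"
proof -
  have "Gamma (c * z) / Gamma z = rGamma z / rGamma (c * z)"
    by (simp add: Gamma_def divide_inverse mult.commute)
  also have "\<dots> = (z * rGamma (z + 1)) / (c * z * rGamma (c * z + 1))"
    by (simp only: rGamma_plus1)
  also have "\<dots> = rGamma (z + 1) / (c * rGamma (c * z + 1))"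
    using assms by simp
  finally show ?thesis .
qed

theorem theorem1:
  fixes n :: nat
  assumes "n > 0"
  shows "((\<lambda>z::complex. Gamma (of_nat n * z) / Gamma z) \<longlongrightarrow> 1 / of_nat n) (at 0)"
proof -
  let ?g = "\<lambda>z::complex. rGamma (z + 1) / (of_nat n * rGamma (of_nat n * z + 1))"
  have "isCont ?g 0"
    using assms by (intro continuous_intros) auto
  then have "(?g \<longlongrightarrow> 1 / of_nat n) (at 0)"
    by (simp add: isCont_def)
  moreover have "eventually (\<lambda>z. ?g z = Gamma (of_nat n * z) / Gamma z) (at 0)"
    using Gamma_quotient_eq_rGamma_quotient by (auto simp: eventually_at_filter)
  ultimately show ?thesis
    by (rule Lim_transform_eventually)
qed

end
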